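(* In the $K$-path network, there is a unique equilibrium of the content routing game without incentives: $\hat{x}_1=1$ and $\hat{x}_2=\cdots=\hat{x}_K=0$. The price of anarchy without incentive design is $$PoA=\inf_{\theta_0,Q_1,Q_0,c_H}\frac{SW(1,0,\dots,0)}{SW(x_1^*,\dots,x_K^* )}=\frac1K .$$
   Context: Let $K\ge3$. A unit mass of non-atomic users, all of valuation $\theta_0>0$, travels from $s$ to $t$. All routes share a costless common link on which the fixed content $Q_0\ge0$ is collected; then each user selects one of $K$ parallel links $P_1,\dots,P_K$, with travel cost $c_k=\frac{k-1}{K-1}c_H$ on $P_k$, $c_H>0$. A flow is $(x_1,\dots,x_K)$ with $x_k\ge0$, $\sum_kx_k=1$. The total content is $Q(x_1,\dots,x_K)=Q_0+\sum_{k=1}^KQ_1(x_k)$, where $Q_1:[0,1]\to[0,\infty)$ is continuous, concave, nondecreasing, not identically zero, with $Q_1(0)=0$. A user choosing $P_k$ has payoff $\theta_0Q(x_1,\dots,x_K)-c_k$ (a single user's choice does not affect the flow). A flow is an equilibrium if no user can increase her payoff by deviating to another path. Social welfare is $SW(x_1,\dots,x_K)=\theta_0Q(x_1,\dots,x_K)-\sum_kc_kx_k$, and $(x_1^*,\dots,x_K^* )$ maximizes it over flows. *)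

theory Defs
  imports "HOL-Analysis.Analysis"
begin

definition link_cost :: "nat \<Rightarrow> real \<Rightarrow> nat \<Rightarrow> real" where
  "link_cost K cH k = (real k - 1) / (real K - 1) * cH"

text \<open>
  A flow is indexed by \<open>{1..K}\<close> and padded with zeros outside that set, so that
  two flows agree on all links iff they are equal as functions.
\<close>

definition flows :: "nat \<Rightarrow> (nat \<Rightarrow> real) set" where
  "flows K = {x. (\<forall>k\<in>{1..K}. 0 \<le> x k) \<and> (\<Sum>k=1..K. x k) = 1 \<and> (\<forall>k. k \<notin> {1..K} \<longrightarrow> x k = 0)}"

definition first_link_flow :: "nat \<Rightarrow> real" where
  "first_link_flow k = (if k = 1 then 1 else 0)"

text \<open>The values of \<open>Q1\<close> outside \<open>{0..1}\<close> are irrelevant: no flow ever uses them.\<close>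

definition content_function :: "(real \<Rightarrow> real) \<Rightarrow> bool" where
  "content_function Q1 \<longleftrightarrow>
     continuous_on {0..1} Q1 \<and> concave_on {0..1} Q1 \<and> mono_on {0..1} Q1 \<and>
     (\<forall>x\<in>{0..1}. 0 \<le> Q1 x) \<and> (\<exists>x\<in>{0..1}. Q1 x \<noteq> 0) \<and> Q1 0 = 0"

definition admissible :: "real \<Rightarrow> real \<Rightarrow> (real \<Rightarrow> real) \<Rightarrow> real \<Rightarrow> bool" where
  "admissible \<theta>0 Q0 Q1 cH \<longleftrightarrow> 0 < \<theta>0 \<and> 0 \<le> Q0 \<and> content_function Q1 \<and> 0 < cH"

definition total_content :: "nat \<Rightarrow> real \<Rightarrow> (real \<Rightarrow> real) \<Rightarrow> (nat \<Rightarrow> real) \<Rightarrow> real" where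
  "total_content K Q0 Q1 x = Q0 + (\<Sum>k=1..K. Q1 (x k))"

definition payoff ::
    "nat \<Rightarrow> real \<Rightarrow> real \<Rightarrow> (real \<Rightarrow> real) \<Rightarrow> real \<Rightarrow> (nat \<Rightarrow> real) \<Rightarrow> nat \<Rightarrow> real" where
  "payoff K \<theta>0 Q0 Q1 cH x k = \<theta>0 * total_content K Q0 Q1 x - link_cost K cH k"

text \<open>
  Users are non-atomic: some user travels on link \<open>k\<close> iff \<open>x k > 0\<close>, and the deviation
  of a single user leaves the flow \<open>x\<close>, hence the total content, unchanged.
\<close>

definition equilibrium ::
    "nat \<Rightarrow> real \<Rightarrow> real \<Rightarrow> (real \<Rightarrow> real) \<Rightarrow> real \<Rightarrow> (nat \<Rightarrow> real) \<Rightarrow> bool" where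
  "equilibrium K \<theta>0 Q0 Q1 cH x \<longleftrightarrow>
     x \<in> flows K \<and>
     (\<forall>k\<in>{1..K}. x k > 0 \<longrightarrow>
        (\<forall>j\<in>{1..K}. payoff K \<theta>0 Q0 Q1 cH x j \<le> payoff K \<theta>0 Q0 Q1 cH x k))"

definition social_welfare ::
    "nat \<Rightarrow> real \<Rightarrow> real \<Rightarrow> (real \<Rightarrow> real) \<Rightarrow> real \<Rightarrow> (nat \<Rightarrow> real) \<Rightarrow> real" where
  "social_welfare K \<theta>0 Q0 Q1 cH x =
     \<theta>0 * total_content K Q0 Q1 x - (\<Sum>k=1..K. link_cost K cH k * x k)"

text \<open>
  A maximizer exists for admissible parameters, since \<^term>\<open>flows K\<close> is compact for
  \<open>K \<ge> 1\<close> and social welfare is continuous on it; \<^const>\<open>arg_max_on\<close> selects one, and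
  the maximal welfare does not depend on which.
\<close>

definition optimal_flow ::
    "nat \<Rightarrow> real \<Rightarrow> real \<Rightarrow> (real \<Rightarrow> real) \<Rightarrow> real \<Rightarrow> nat \<Rightarrow> real" where
  "optimal_flow K \<theta>0 Q0 Q1 cH = arg_max_on (social_welfare K \<theta>0 Q0 Q1 cH) (flows K)"

text \<open>
  The set below is nonempty and bounded below by \<open>0\<close>, so the infimum in the reals is the
  genuine one; all denominators are positive since \<open>Q1 1 > 0\<close>.
\<close>

definition price_of_anarchy :: "nat \<Rightarrow> real" where
  "price_of_anarchy K =
     Inf {social_welfare K \<theta>0 Q0 Q1 cH first_link_flow /
            social_welfare K \<theta>0 Q0 Q1 cH (optimal_flow K \<theta>0 Q0 Q1 cH)
          | \<theta>0 Q0 Q1 cH. admissible \<theta>0 Q0 Q1 cH}"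

end

theory Submission
  imports Defs
begin

text \<open>
  Every user prefers the free link, as content does not depend on her own choice; hence the
  equilibrium. Its welfare is \<open>\<theta>0 * (Q0 + Q1 1)\<close>, whereas no flow exceeds
  \<open>\<theta>0 * (Q0 + K * Q1 1)\<close> by monotonicity of \<open>Q1\<close>, so the ratio is at least \<open>1 / K\<close>.
  For \<open>Q0 = 0\<close> and \<open>Q1 x = min 1 (K * x)\<close> the uniform flow collects content \<open>K\<close> at a cost
  of at most \<open>cH\<close>, and \<open>cH\<close> may be arbitrarily small.
\<close>

lemma link_cost_first [simp]: "link_cost K cH (Suc 0) = 0"
  by (simp add: link_cost_def)

lemma link_cost_pos:
  assumes "K \<ge> 2" "0 < cH" "k > 1"
  shows "0 < link_cost K cH k"
  using assms by (simp add: link_cost_def)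

lemma link_cost_nonneg:
  assumes "K \<ge> 2" "0 < cH" "k \<ge> 1"
  shows "0 \<le> link_cost K cH k"
  using assms by (simp add: link_cost_def)

lemma link_cost_le:
  assumes "K \<ge> 2" "0 < cH" "k \<le> K"
  shows "link_cost K cH k \<le> cH"
proof -
  have "(real k - 1) / (real K - 1) \<le> 1"
    using assms by (simp add: divide_le_eq)
  then show ?thesis
    using assms unfolding link_cost_def by (metis less_eq_real_def mult.left_neutral mult_right_mono)
qed

lemma first_link_flow_in_flows:
  assumes "K \<ge> 1"
  shows "first_link_flow \<in> flows K"
  using assms by (auto simp: flows_def first_link_flow_def sum.delta)

lemma flow_bounds:
  assumes "x \<in> flows K" "k \<in> {1..K}"
  shows "0 \<le> x k" "x k \<le> 1"
proof -
  show "0 \<le> x k"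
    using assms by (auto simp: flows_def)
  have "x k \<le> (\<Sum>k=1..K. x k)"
    using assms by (intro member_le_sum) (auto simp: flows_def)
  then show "x k \<le> 1"
    using assms by (simp add: flows_def)
qed

lemma equilibrium_iff_first_link_flow:
  assumes "K \<ge> 2" "0 < cH"
  shows "equilibrium K \<theta>0 Q0 Q1 cH x \<longleftrightarrow> x = first_link_flow"
proof
  assume eq: "equilibrium K \<theta>0 Q0 Q1 cH x"
  then have x: "x \<in> flows K"
    by (simp add: equilibrium_def)
  have zero: "x k = 0" if "k \<noteq> 1" for k
  proof (cases "k \<in> {1..K}")
    case True
    \<comment> \<open>The total content is the same term in \<open>payoff\<close> for every link, so
      comparing payoffs is comparing link costs, and a user on such a link would gain by moving to
      link 1.\<close>
    then have "\<not> link_cost K cH k \<le> link_cost K cH 1"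
      using link_cost_pos[of K cH k] assms that by simp
    moreover have "1 \<in> {1..K}"
      using assms by simp
    ultimately have "\<not> x k > 0"
      using eq True unfolding equilibrium_def payoff_def by fastforce
    then show ?thesis
      using flow_bounds(1)[OF x True] by simp
  next
    case False
    then show ?thesis
      using x by (auto simp: flows_def)
  qed
  have "(\<Sum>k=1..K. x k) = (\<Sum>k\<in>{1}. x k)"
    using assms zero by (intro sum.mono_neutral_right) auto
  then have "x 1 = 1"
    using x by (simp add: flows_def)
  with zero show "x = first_link_flow"
    by (auto simp: first_link_flow_def)
next
  assume "x = first_link_flow"
  then show "equilibrium K \<theta>0 Q0 Q1 cH x"
    using assms first_link_flow_in_flows[of K] link_cost_nonneg[of K cH]
    by (auto simp: equilibrium_def payoff_def first_link_flow_def split: if_splits)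
qed

text \<open>By Tychonoff: the zero padding makes every factor of the infinite product compact, [0,1]
  on the links and {0} elsewhere, and the mass constraint cuts out a closed set.\<close>

lemma compact_flows: "compact (flows K)"
proof -
  define B where "B = Pi\<^sub>E UNIV (\<lambda>k. if k \<in> {1..K} then {0..1::real} else {0})"
  have "compactin (product_topology (\<lambda>_. euclidean) UNIV) B"
    unfolding B_def by (subst compactin_PiE) auto
  then have "compact B"
    by (simp add: euclidean_product_topology)
  moreover have "closed {x :: nat \<Rightarrow> real. (\<Sum>k=1..K. x k) = 1}"
    by (intro closed_Collect_eq continuous_on_sum continuous_on_product_coordinates continuous_on_const)
  moreover have "flows K = B \<inter> {x. (\<Sum>k=1..K. x k) = 1}"
    using flow_bounds by (fastforce simp: B_def flows_def PiE_iff split: if_splits)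
  ultimately show ?thesis
    by (simp add: compact_Int_closed)
qed

lemma continuous_on_social_welfare:
  assumes "continuous_on {0..1} Q1"
  shows "continuous_on (flows K) (social_welfare K \<theta>0 Q0 Q1 cH)"
proof -
  \<comment> \<open>\<open>Q1\<close> is continuous on [0,1] only, so the composition needs flows to
    take their values there.\<close>
  have "continuous_on (flows K) (\<lambda>x. Q1 (x k))" if "k \<in> {1..K}" for k
    using flow_bounds that
    by (intro continuous_on_compose2[OF assms]
        continuous_on_subset[OF continuous_on_product_coordinates]) auto
  moreover have "continuous_on (flows K) (\<lambda>x. x k)" for k
    by (rule continuous_on_subset[OF continuous_on_product_coordinates]) simp
  ultimately show ?thesis
    unfolding social_welfare_def[abs_def] total_content_def
    by (intro continuous_intros) auto
qed

text \<open>\<open>arg_max_on\<close> is a Hilbert choice and says nothing until some maximizer is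
  known to exist; compactness and continuity supply one.\<close>

lemma optimal_flow:
  assumes "K \<ge> 1" "continuous_on {0..1} Q1"
  shows "optimal_flow K \<theta>0 Q0 Q1 cH \<in> flows K" (is ?in)
    and "x \<in> flows K \<Longrightarrow>
      social_welfare K \<theta>0 Q0 Q1 cH x \<le> social_welfare K \<theta>0 Q0 Q1 cH (optimal_flow K \<theta>0 Q0 Q1 cH)"
proof -
  let ?W = "social_welfare K \<theta>0 Q0 Q1 cH"
  have "flows K \<noteq> {}"
    using first_link_flow_in_flows assms by blast
  then obtain y where "y \<in> flows K" "\<forall>x\<in>flows K. ?W x \<le> ?W y"
    using continuous_attains_sup[OF compact_flows _ continuous_on_social_welfare] assms by blast
  then have "is_arg_max ?W (\<lambda>x. x \<in> flows K) y"
    by (auto simp: is_arg_max_linorder)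
  then have "is_arg_max ?W (\<lambda>x. x \<in> flows K) (optimal_flow K \<theta>0 Q0 Q1 cH)"
    unfolding optimal_flow_def arg_max_on_def arg_max_def by (rule someI[where P = "is_arg_max _ _"])
  then show ?in "x \<in> flows K \<Longrightarrow> ?W x \<le> ?W (optimal_flow K \<theta>0 Q0 Q1 cH)"
    by (auto simp: is_arg_max_linorder)
qed

text \<open>Monotonicity carries any nonzero value of \<open>Q1\<close> to the endpoint 1. This is
  what makes the welfare ratios well defined.\<close>

lemma content_function_at_1_pos:
  assumes "content_function Q1"
  shows "0 < Q1 1"
proof -
  obtain x where "x \<in> {0..1}" "0 \<le> Q1 x" "Q1 x \<noteq> 0"
    using assms by (auto simp: content_function_def)
  moreover from this have "Q1 x \<le> Q1 1"
    using assms by (auto simp: content_function_def intro: mono_onD)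
  ultimately show ?thesis
    by simp
qed

lemma social_welfare_first_link_flow:
  assumes "K \<ge> 1" "Q1 0 = 0"
  shows "social_welfare K \<theta>0 Q0 Q1 cH first_link_flow = \<theta>0 * (Q0 + Q1 1)"
proof -
  have "(\<Sum>k=1..K. Q1 (first_link_flow k)) = (\<Sum>k=1..K. if k = 1 then Q1 1 else 0)"
    using assms by (intro sum.cong) (auto simp: first_link_flow_def)
  moreover have "(\<Sum>k=1..K. link_cost K cH k * first_link_flow k) = 0"
    by (intro sum.neutral) (auto simp: first_link_flow_def)
  ultimately show ?thesis
    using assms by (simp add: social_welfare_def total_content_def)
qed

lemma social_welfare_le:
  assumes "K \<ge> 2" "admissible \<theta>0 Q0 Q1 cH" "x \<in> flows K"
  shows "social_welfare K \<theta>0 Q0 Q1 cH x \<le> \<theta>0 * (Q0 + real K * Q1 1)"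
proof -
  have "(\<Sum>k=1..K. Q1 (x k)) \<le> (\<Sum>k=1..K. Q1 1)"
    using assms flow_bounds[OF assms(3)]
    by (intro sum_mono) (auto simp: admissible_def content_function_def intro: mono_onD)
  then have "\<theta>0 * total_content K Q0 Q1 x \<le> \<theta>0 * (Q0 + real K * Q1 1)"
    using assms by (simp add: total_content_def admissible_def)
  moreover have "0 \<le> (\<Sum>k=1..K. link_cost K cH k * x k)"
    using assms link_cost_nonneg flow_bounds[OF assms(3)]
    by (intro sum_nonneg mult_nonneg_nonneg) (auto simp: admissible_def)
  ultimately show ?thesis
    by (simp add: social_welfare_def)
qed

lemma welfare_ratio_ge:
  assumes "K \<ge> 2" "admissible \<theta>0 Q0 Q1 cH"
  shows "1 / real K \<le> social_welfare K \<theta>0 Q0 Q1 cH first_link_flow /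
    social_welfare K \<theta>0 Q0 Q1 cH (optimal_flow K \<theta>0 Q0 Q1 cH)" (is "_ \<le> ?F / ?O")
proof -
  have adm: "0 < \<theta>0" "0 \<le> Q0" "content_function Q1" "continuous_on {0..1} Q1"
    using assms by (auto simp: admissible_def content_function_def)
  have F: "?F = \<theta>0 * (Q0 + Q1 1)"
    using adm assms by (intro social_welfare_first_link_flow) (auto simp: content_function_def)
  then have "0 < ?F"
    using adm content_function_at_1_pos[of Q1] by simp
  \<comment> \<open>Together with \<open>0 < ?F\<close> this gives a positive denominator, so the
    quotient can be cleared.\<close>
  moreover have "?F \<le> ?O"
    using assms adm by (intro optimal_flow first_link_flow_in_flows) auto
  moreover have "?O \<le> \<theta>0 * (Q0 + real K * Q1 1)"
    using assms adm by (intro social_welfare_le optimal_flow) auto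
  \<comment> \<open>The fixed content only helps the ratio, since \<open>Q0\<close> is at most
    \<open>K * Q0\<close>.\<close>
  moreover have "Q0 + real K * Q1 1 \<le> real K * (Q0 + Q1 1)"
    using adm assms mult_right_mono[of 1 "real K" Q0] by (simp add: algebra_simps)
  then have "\<theta>0 * (Q0 + real K * Q1 1) \<le> real K * ?F"
    using F adm by (simp add: mult.left_commute)
  ultimately show ?thesis
    using assms by (simp add: field_simps)
qed

text \<open>The cap is reached exactly at 1/K, the share of each link in the uniform flow, so
  spreading the users evenly saturates all links.\<close>

lemma content_function_min_linear:
  assumes "K \<ge> 1"
  shows "content_function (\<lambda>x. min 1 (real K * x))"
proof -
  have "concave_on {0..1} (\<lambda>x. min 1 (real K * x))"
  proof (unfold concave_on_iff, intro conjI ballI allI impI)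
    fix x y u v :: real
    assume uv: "0 \<le> u" "0 \<le> v" "u + v = 1"
    let ?m = "\<lambda>x. min 1 (real K * x)"
    \<comment> \<open>A minimum of two affine functions is concave: the convex combination is
      bounded by each of them separately.\<close>
    have "u * ?m x + v * ?m y \<le> u * 1 + v * 1"
      using uv by (intro add_mono mult_left_mono) auto
    moreover have "u * ?m x + v * ?m y \<le> u * (real K * x) + v * (real K * y)"
      using uv by (intro add_mono mult_left_mono) auto
    ultimately show "u * ?m x + v * ?m y \<le> ?m (u *\<^sub>R x + v *\<^sub>R y)"
      using uv by (simp add: algebra_simps)
  qed simp
  moreover have "continuous_on {0..1} (\<lambda>x. min 1 (real K * x))"
    by (intro continuous_intros)
  moreover have "mono_on {0..1} (\<lambda>x. min 1 (real K * x))"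
    by (intro mono_onI min.mono mult_left_mono) auto
  moreover have "\<exists>x\<in>{0..1}. min 1 (real K * x) \<noteq> 0"
    using assms by (intro bexI[of _ 1]) auto
  ultimately show ?thesis
    by (simp add: content_function_def)
qed

lemma uniform_flow:
  assumes "K \<ge> 2" "0 < cH"
  obtains x where "x \<in> flows K"
    "real K - cH \<le> social_welfare K 1 0 (\<lambda>x. min 1 (real K * x)) cH x"
proof
  let ?u = "\<lambda>k. if k \<in> {1..K} then 1 / real K else 0"
  show u: "?u \<in> flows K"
    using assms by (auto simp: flows_def)
  \<comment> \<open>The exact cost is \<open>cH / 2\<close>; the cruder bound \<open>cH\<close>
    suffices because \<open>cH\<close> will tend to 0.\<close>
  have "(\<Sum>k=1..K. link_cost K cH k * ?u k) \<le> (\<Sum>k=1..K. cH * ?u k)"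
    using assms link_cost_le by (intro sum_mono mult_right_mono) auto
  also have "\<dots> = cH"
    using u unfolding flows_def sum_distrib_left[symmetric] by (simp del: sum.delta)
  finally show "real K - cH \<le> social_welfare K 1 0 (\<lambda>x. min 1 (real K * x)) cH ?u"
    using assms by (simp add: social_welfare_def total_content_def)
qed

theorem proposition6:
  fixes K :: nat
  assumes "K \<ge> 3"
  shows "(\<forall>\<theta>0 Q0 Q1 cH. admissible \<theta>0 Q0 Q1 cH \<longrightarrow>
            (\<forall>x. equilibrium K \<theta>0 Q0 Q1 cH x \<longleftrightarrow> x = first_link_flow))
         \<and> price_of_anarchy K = 1 / real K"
proof
  show "\<forall>\<theta>0 Q0 Q1 cH. admissible \<theta>0 Q0 Q1 cH \<longrightarrow>
            (\<forall>x. equilibrium K \<theta>0 Q0 Q1 cH x \<longleftrightarrow> x = first_link_flow)"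
    using assms equilibrium_iff_first_link_flow[of K] by (simp add: admissible_def)
next
  let ?W = "social_welfare K"
  let ?R = "{?W \<theta>0 Q0 Q1 cH first_link_flow / ?W \<theta>0 Q0 Q1 cH (optimal_flow K \<theta>0 Q0 Q1 cH)
              | \<theta>0 Q0 Q1 cH. admissible \<theta>0 Q0 Q1 cH}"
  let ?Q = "\<lambda>x. min 1 (real K * x)"
  have Q: "content_function ?Q"
    using assms by (intro content_function_min_linear) simp
  have adm: "admissible 1 0 ?Q cH" if "0 < cH" for cH
    using Q that by (simp add: admissible_def)
  have ge: "1 / real K \<le> r" if "r \<in> ?R" for r
    using that assms welfare_ratio_ge[of K] by auto
  \<comment> \<open>The restriction \<open>cH < 1\<close> keeps \<open>real K - cH\<close>
    positive.\<close>
  have le: "price_of_anarchy K \<le> 1 / (real K - cH)" if cH: "0 < cH" "cH < 1" for cH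
  proof -
    let ?O = "?W 1 0 ?Q cH (optimal_flow K 1 0 ?Q cH)"
    obtain x where "x \<in> flows K" "real K - cH \<le> ?W 1 0 ?Q cH x"
      using uniform_flow[of K cH] assms cH by auto
    moreover from this have "?W 1 0 ?Q cH x \<le> ?O"
      using Q assms by (intro optimal_flow) (auto simp: content_function_def)
    ultimately have O: "real K - cH \<le> ?O"
      by simp
    have F: "?W 1 0 ?Q cH first_link_flow = 1"
      using assms by (subst social_welfare_first_link_flow) auto
    have "price_of_anarchy K \<le> ?W 1 0 ?Q cH first_link_flow / ?O"
      unfolding price_of_anarchy_def
    proof (rule cInf_lower)
      \<comment> \<open>An infimum in the reals lies below the members of the set only if the set is
        bounded below; the bound 1/K does this.\<close>
      show "bdd_below ?R"
        using ge by (rule bdd_belowI)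
    qed (use adm cH in blast)
    also have "\<dots> \<le> 1 / (real K - cH)"
      unfolding F using O assms cH by (intro divide_left_mono mult_pos_pos) auto
    finally show ?thesis .
  qed
  \<comment> \<open>The value \<open>cH = 0\<close> is not admissible, so the bound is obtained as a
    limit from the right. The unsimplified \<open>real K - 0\<close> is the form in which the limit
    rules produce it.\<close>
  have "price_of_anarchy K \<le> 1 / (real K - 0)"
  proof (rule tendsto_lowerbound)
    show "((\<lambda>cH. 1 / (real K - cH)) \<longlongrightarrow> 1 / (real K - 0)) (at_right 0)"
      using assms by (intro tendsto_intros) auto
    show "\<forall>\<^sub>F cH in at_right 0. price_of_anarchy K \<le> 1 / (real K - cH)"
      using le eventually_at_right_real[of 0 1] by (auto elim: eventually_mono)
  qed simp
  moreover have "1 / real K \<le> price_of_anarchy K"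
    unfolding price_of_anarchy_def
  proof (rule cInf_greatest)
    \<comment> \<open>The instance with \<open>cH = 1\<close> is a member.\<close>
    show "?R \<noteq> {}"
      using adm[of 1] by auto
  qed (rule ge)
  ultimately show "price_of_anarchy K = 1 / real K"
    by simp
qed

end
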